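(* Let $(M,\phi,\xi,\eta,g)$ be a $(2n+1)$-dimensional Kenmotsu manifold, let $a>0$ be a constant, and let $(\overline{\phi},\overline{\xi},\overline{\eta},\overline{g})$ be the $D$-homothetically deformed structure on $M$. Let $f\in C^\infty(M)$. If $(V=\overline{\mathrm{grad}}(f),\overline{\lambda})$ defines a gradient almost Ricci soliton in $(M,\overline{g})$, then $$\overline{\lambda}=\frac{1}{a^2}\mathrm{Hess}(f)(\xi,\xi)-\frac{2n}{a^2}.$$
   Context: An almost contact metric manifold $(M,\phi,\xi,\eta,g)$ is an odd-dimensional Riemannian manifold $(M,g)$, here of dimension $2n+1$ with $n\ge 1$, together with a $(1,1)$-tensor field $\phi$, a vector field $\xi$ (the Reeb vector field) and a $1$-form $\eta$ such that $\phi^2=-I+\eta\otimes\xi$, $\eta(\xi)=1$, $\eta=g(\xi,\cdot)$ and $g(\phi X,\phi Y)=g(X,Y)-\eta(X)\eta(Y)$. It is a Kenmotsu manifold if the Levi-Civita connection $\nabla$ of $g$ satisfies $(\nabla_X\phi)Y=g(\phi X,Y)\xi-\eta(Y)\phi X$ for all vector fields $X,Y$. For a constant $a>0$, the $D$-homothetically deformed structure is $\overline{\phi}=\phi$, $\overline{\xi}=\frac{1}{a}\xi$, $\overline{\eta}=a\eta$, $\overline{g}=ag+a(a-1)\eta\otimes\eta$. For a Riemannian metric $h$, a nowhere-vanishing vector field $V$ and a smooth function $\lambda$ on $M$, the pair $(V,\lambda)$ defines an almost Ricci soliton in $(M,h)$ if $\frac12\mathcal{L}_Vh+\mathrm{Ric}_h=\lambda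 h$, where $\mathcal{L}$ is the Lie derivative and $\mathrm{Ric}_h$ the Ricci tensor of $h$; it is called gradient if $V$ is the $h$-gradient of a smooth function. $\mathrm{Hess}$ is the Hessian with respect to $g$; $\overline{\mathrm{grad}}$ is the gradient with respect to $\overline{g}$. *)

theory Defs
  imports "HOL-Analysis.Analysis"
begin

section \<open>Smooth maps between Euclidean spaces\<close>

text \<open>The set \<open>S\<close> is always open where these notions are used.\<close>

primrec times_differentiable_on ::
    "nat \<Rightarrow> 'a::real_normed_vector set \<Rightarrow> ('a \<Rightarrow> 'b::real_normed_vector) \<Rightarrow> bool" where
  "times_differentiable_on 0 S f \<longleftrightarrow> continuous_on S f"
| "times_differentiable_on (Suc k) S f \<longleftrightarrow>
     (\<forall>x\<in>S. f differentiable (at x)) \<and>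
     (\<forall>v. times_differentiable_on k S (\<lambda>x. frechet_derivative f (at x) v))"

definition smooth_on :: "'a::real_normed_vector set \<Rightarrow> ('a \<Rightarrow> 'b::real_normed_vector) \<Rightarrow> bool" where
  "smooth_on S f \<longleftrightarrow> (\<forall>k. times_differentiable_on k S f)"

section \<open>Smooth manifolds\<close>

text \<open>
  A manifold is a Hausdorff second countable type \<open>'m\<close> together with a smooth atlas \<open>A\<close>; its
  dimension is \<open>DIM('e)\<close>. A chart is a pair of its domain and its coordinate map.
\<close>

type_synonym ('m, 'e) chart = "'m set \<times> ('m \<Rightarrow> 'e)"

definition chart_inv :: "('m, 'e) chart \<Rightarrow> 'e \<Rightarrow> 'm" where
  "chart_inv c = inv_into (fst c) (snd c)"

definition chart_image :: "('m, 'e) chart \<Rightarrow> 'e set" where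
  "chart_image c = snd c ` fst c"

definition is_chart :: "('m::topological_space, 'e::euclidean_space) chart \<Rightarrow> bool" where
  "is_chart c \<longleftrightarrow> open (fst c) \<and> open (chart_image c) \<and>
     homeomorphism (fst c) (chart_image c) (snd c) (chart_inv c)"

definition smooth_atlas ::
    "('m::{t2_space,second_countable_topology}, 'e::euclidean_space) chart set \<Rightarrow> bool" where
  "smooth_atlas A \<longleftrightarrow> (\<forall>c\<in>A. is_chart c) \<and> (\<Union>c\<in>A. fst c) = UNIV \<and>
     (\<forall>c\<in>A. \<forall>d\<in>A. smooth_on (snd c ` (fst c \<inter> fst d)) (snd d \<circ> chart_inv c))"

definition smooth_function ::
    "('m, 'e::euclidean_space) chart set \<Rightarrow> ('m \<Rightarrow> real) \<Rightarrow> bool" where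
  "smooth_function A f \<longleftrightarrow> (\<forall>c\<in>A. smooth_on (chart_image c) (f \<circ> chart_inv c))"

text \<open>
  The tangent space at \<open>p\<close> is represented by the model space \<open>'e\<close>: a chart \<open>chart_at A p\<close>
  around \<open>p\<close> is chosen once and for all, and \<open>v :: 'e\<close> stands for the tangent vector at \<open>p\<close>
  having coordinates \<open>v\<close> in that chart. The coordinates of the same tangent vector in another
  chart \<open>c\<close> around \<open>p\<close> are \<open>tangent_coord A c p v\<close>. A vector field is thus a function of type
  \<open>'m \<Rightarrow> 'e\<close>, an endomorphism field one of type \<open>'m \<Rightarrow> 'e \<Rightarrow> 'e\<close>, and so on. As the chosen chart
  varies with the point without any continuity, smoothness of a vector field refers to its
  coordinate representation in the charts of the atlas.
\<close>

definition chart_at :: "('m, 'e) chart set \<Rightarrow> 'm \<Rightarrow> ('m, 'e) chart" where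
  "chart_at A p = (SOME c. c \<in> A \<and> p \<in> fst c)"

definition tangent_coord ::
    "('m, 'e::euclidean_space) chart set \<Rightarrow> ('m, 'e) chart \<Rightarrow> 'm \<Rightarrow> 'e \<Rightarrow> 'e" where
  "tangent_coord A c p v =
     frechet_derivative (snd c \<circ> chart_inv (chart_at A p)) (at (snd (chart_at A p) p)) v"

definition coord_rep ::
    "('m, 'e::euclidean_space) chart set \<Rightarrow> ('m, 'e) chart \<Rightarrow> ('m \<Rightarrow> 'e) \<Rightarrow> 'e \<Rightarrow> 'e" where
  "coord_rep A c X x = tangent_coord A c (chart_inv c x) (X (chart_inv c x))"

definition vector_field :: "('m, 'e::euclidean_space) chart set \<Rightarrow> ('m \<Rightarrow> 'e) \<Rightarrow> bool" where
  "vector_field A X \<longleftrightarrow> (\<forall>c\<in>A. smooth_on (chart_image c) (coord_rep A c X))"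

definition differential ::
    "('m, 'e::euclidean_space) chart set \<Rightarrow> ('m \<Rightarrow> real) \<Rightarrow> 'm \<Rightarrow> 'e \<Rightarrow> real" where
  "differential A f p v =
     frechet_derivative (f \<circ> chart_inv (chart_at A p)) (at (snd (chart_at A p) p)) v"

definition deriv_along ::
    "('m, 'e::euclidean_space) chart set \<Rightarrow> ('m \<Rightarrow> 'e) \<Rightarrow> ('m \<Rightarrow> real) \<Rightarrow> 'm \<Rightarrow> real" where
  "deriv_along A X f p = differential A f p (X p)"

text \<open>In coordinates \<open>[X, Y] = DY X - DX Y\<close>, so that \<open>[X, Y] f = X (Y f) - Y (X f)\<close>.\<close>

definition lie_bracket ::
    "('m, 'e::euclidean_space) chart set \<Rightarrow> ('m \<Rightarrow> 'e) \<Rightarrow> ('m \<Rightarrow> 'e) \<Rightarrow> 'm \<Rightarrow> 'e" where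
  "lie_bracket A X Y p = (let c = chart_at A p in
     frechet_derivative (coord_rep A c Y) (at (snd c p)) (X p) -
     frechet_derivative (coord_rep A c X) (at (snd c p)) (Y p))"

text \<open>Smoothness of covariant tensor and endomorphism fields is tested on smooth vector fields.\<close>

definition one_form :: "('m, 'e::euclidean_space) chart set \<Rightarrow> ('m \<Rightarrow> 'e \<Rightarrow> real) \<Rightarrow> bool" where
  "one_form A \<omega> \<longleftrightarrow> (\<forall>p. linear (\<omega> p)) \<and>
     (\<forall>X. vector_field A X \<longrightarrow> smooth_function A (\<lambda>p. \<omega> p (X p)))"

definition endomorphism_field ::
    "('m, 'e::euclidean_space) chart set \<Rightarrow> ('m \<Rightarrow> 'e \<Rightarrow> 'e) \<Rightarrow> bool" where
  "endomorphism_field A \<phi> \<longleftrightarrow> (\<forall>p. linear (\<phi> p)) \<and>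
     (\<forall>X. vector_field A X \<longrightarrow> vector_field A (\<lambda>p. \<phi> p (X p)))"

definition riemannian_metric ::
    "('m, 'e::euclidean_space) chart set \<Rightarrow> ('m \<Rightarrow> 'e \<Rightarrow> 'e \<Rightarrow> real) \<Rightarrow> bool" where
  "riemannian_metric A h \<longleftrightarrow>
     (\<forall>p. bilinear (h p) \<and> (\<forall>v w. h p v w = h p w v) \<and> (\<forall>v. v \<noteq> 0 \<longrightarrow> h p v v > 0)) \<and>
     (\<forall>X Y. vector_field A X \<longrightarrow> vector_field A Y \<longrightarrow>
        smooth_function A (\<lambda>p. h p (X p) (Y p)))"

section \<open>The Levi-Civita connection, curvature and related operators\<close>

text \<open>\<open>D X Y\<close> is the covariant derivative of \<open>Y\<close> along \<open>X\<close>.\<close>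

type_synonym ('m, 'e) connection = "('m \<Rightarrow> 'e) \<Rightarrow> ('m \<Rightarrow> 'e) \<Rightarrow> 'm \<Rightarrow> 'e"

definition affine_connection ::
    "('m, 'e::euclidean_space) chart set \<Rightarrow> ('m, 'e) connection \<Rightarrow> bool" where
  "affine_connection A D \<longleftrightarrow>
     (\<forall>X Y. vector_field A X \<longrightarrow> vector_field A Y \<longrightarrow> vector_field A (D X Y)) \<and>
     (\<forall>X Y Z. vector_field A X \<longrightarrow> vector_field A Y \<longrightarrow> vector_field A Z \<longrightarrow>
        D (\<lambda>p. X p + Y p) Z = (\<lambda>p. D X Z p + D Y Z p) \<and>
        D X (\<lambda>p. Y p + Z p) = (\<lambda>p. D X Y p + D X Z p)) \<and>
     (\<forall>f X Y. smooth_function A f \<longrightarrow> vector_field A X \<longrightarrow> vector_field A Y \<longrightarrow>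
        D (\<lambda>p. f p *\<^sub>R X p) Y = (\<lambda>p. f p *\<^sub>R D X Y p) \<and>
        D X (\<lambda>p. f p *\<^sub>R Y p) = (\<lambda>p. deriv_along A X f p *\<^sub>R Y p + f p *\<^sub>R D X Y p))"

definition torsion_free ::
    "('m, 'e::euclidean_space) chart set \<Rightarrow> ('m, 'e) connection \<Rightarrow> bool" where
  "torsion_free A D \<longleftrightarrow> (\<forall>X Y p. vector_field A X \<longrightarrow> vector_field A Y \<longrightarrow>
     D X Y p - D Y X p = lie_bracket A X Y p)"

definition metric_connection ::
    "('m, 'e::euclidean_space) chart set \<Rightarrow> ('m \<Rightarrow> 'e \<Rightarrow> 'e \<Rightarrow> real) \<Rightarrow>
     ('m, 'e) connection \<Rightarrow> bool" where
  "metric_connection A h D \<longleftrightarrow>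
     (\<forall>X Y Z p. vector_field A X \<longrightarrow> vector_field A Y \<longrightarrow> vector_field A Z \<longrightarrow>
        deriv_along A X (\<lambda>q. h q (Y q) (Z q)) p = h p (D X Y p) (Z p) + h p (Y p) (D X Z p))"

definition is_levi_civita ::
    "('m, 'e::euclidean_space) chart set \<Rightarrow> ('m \<Rightarrow> 'e \<Rightarrow> 'e \<Rightarrow> real) \<Rightarrow>
     ('m, 'e) connection \<Rightarrow> bool" where
  "is_levi_civita A h D \<longleftrightarrow> affine_connection A D \<and> torsion_free A D \<and> metric_connection A h D"

text \<open>
  A Levi-Civita connection is uniquely determined only on smooth vector fields, since its values
  at non-smooth arguments are not constrained; hence the choice instead of a definite description.
\<close>

definition levi_civita ::
    "('m, 'e::euclidean_space) chart set \<Rightarrow> ('m \<Rightarrow> 'e \<Rightarrow> 'e \<Rightarrow> real) \<Rightarrow> ('m, 'e) connection" where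
  "levi_civita A h = (SOME D. is_levi_civita A h D)"

definition curvature ::
    "('m, 'e::euclidean_space) chart set \<Rightarrow> ('m \<Rightarrow> 'e \<Rightarrow> 'e \<Rightarrow> real) \<Rightarrow>
     ('m \<Rightarrow> 'e) \<Rightarrow> ('m \<Rightarrow> 'e) \<Rightarrow> ('m \<Rightarrow> 'e) \<Rightarrow> 'm \<Rightarrow> 'e" where
  "curvature A h X Y Z p = (let D = levi_civita A h in
     D X (D Y Z) p - D Y (D X Z) p - D (lie_bracket A X Y) Z p)"

text \<open>
  The trace at \<open>p\<close> of an endomorphism \<open>T\<close> of the module of vector fields that is linear over
  the smooth functions. For such \<open>T\<close> the value \<open>T X p\<close> depends only on \<open>X p\<close>, so any extension
  of a tangent vector to a global vector field may be used.
\<close>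

definition extend_vector ::
    "('m, 'e::euclidean_space) chart set \<Rightarrow> 'm \<Rightarrow> 'e \<Rightarrow> 'm \<Rightarrow> 'e" where
  "extend_vector A p v = (SOME X. vector_field A X \<and> X p = v)"

definition trace_at ::
    "('m, 'e::euclidean_space) chart set \<Rightarrow> (('m \<Rightarrow> 'e) \<Rightarrow> 'm \<Rightarrow> 'e) \<Rightarrow> 'm \<Rightarrow> real" where
  "trace_at A T p = (\<Sum>b\<in>Basis. T (extend_vector A p b) p \<bullet> b)"

definition ricci ::
    "('m, 'e::euclidean_space) chart set \<Rightarrow> ('m \<Rightarrow> 'e \<Rightarrow> 'e \<Rightarrow> real) \<Rightarrow>
     ('m \<Rightarrow> 'e) \<Rightarrow> ('m \<Rightarrow> 'e) \<Rightarrow> 'm \<Rightarrow> real" where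
  "ricci A h Y Z p = trace_at A (\<lambda>X. curvature A h X Y Z) p"

definition lie_derivative_metric ::
    "('m, 'e::euclidean_space) chart set \<Rightarrow> ('m \<Rightarrow> 'e) \<Rightarrow> ('m \<Rightarrow> 'e \<Rightarrow> 'e \<Rightarrow> real) \<Rightarrow>
     ('m \<Rightarrow> 'e) \<Rightarrow> ('m \<Rightarrow> 'e) \<Rightarrow> 'm \<Rightarrow> real" where
  "lie_derivative_metric A V h X Y p =
     deriv_along A V (\<lambda>q. h q (X q) (Y q)) p
     - h p (lie_bracket A V X p) (Y p) - h p (X p) (lie_bracket A V Y p)"

definition gradient ::
    "('m, 'e::euclidean_space) chart set \<Rightarrow> ('m \<Rightarrow> 'e \<Rightarrow> 'e \<Rightarrow> real) \<Rightarrow> ('m \<Rightarrow> real) \<Rightarrow> 'm \<Rightarrow> 'e" where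
  "gradient A h f p = (THE v. \<forall>w. h p v w = differential A f p w)"

definition hessian ::
    "('m, 'e::euclidean_space) chart set \<Rightarrow> ('m \<Rightarrow> 'e \<Rightarrow> 'e \<Rightarrow> real) \<Rightarrow> ('m \<Rightarrow> real) \<Rightarrow>
     ('m \<Rightarrow> 'e) \<Rightarrow> ('m \<Rightarrow> 'e) \<Rightarrow> 'm \<Rightarrow> real" where
  "hessian A h f X Y p =
     deriv_along A X (deriv_along A Y f) p - deriv_along A (levi_civita A h X Y) f p"

section \<open>Kenmotsu manifolds and almost Ricci solitons\<close>

definition almost_contact_metric ::
    "('m, 'e::euclidean_space) chart set \<Rightarrow> ('m \<Rightarrow> 'e \<Rightarrow> 'e) \<Rightarrow> ('m \<Rightarrow> 'e) \<Rightarrow>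
     ('m \<Rightarrow> 'e \<Rightarrow> real) \<Rightarrow> ('m \<Rightarrow> 'e \<Rightarrow> 'e \<Rightarrow> real) \<Rightarrow> bool" where
  "almost_contact_metric A \<phi> \<xi> \<eta> g \<longleftrightarrow>
     odd DIM('e) \<and> riemannian_metric A g \<and>
     endomorphism_field A \<phi> \<and> vector_field A \<xi> \<and> one_form A \<eta> \<and>
     (\<forall>p v. \<phi> p (\<phi> p v) = - v + \<eta> p v *\<^sub>R \<xi> p) \<and>
     (\<forall>p. \<eta> p (\<xi> p) = 1) \<and>
     (\<forall>p v. \<eta> p v = g p (\<xi> p) v) \<and>
     (\<forall>p v w. g p (\<phi> p v) (\<phi> p w) = g p v w - \<eta> p v * \<eta> p w)"

text \<open>
  The left-hand side of the last equation is \<open>(D\<^sub>X \<phi>) Y\<close>. The existentially quantified \<open>D\<close> is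
  the Levi-Civita connection of \<open>g\<close>, which is unique on smooth vector fields.
\<close>

definition kenmotsu ::
    "('m, 'e::euclidean_space) chart set \<Rightarrow> ('m \<Rightarrow> 'e \<Rightarrow> 'e) \<Rightarrow> ('m \<Rightarrow> 'e) \<Rightarrow>
     ('m \<Rightarrow> 'e \<Rightarrow> real) \<Rightarrow> ('m \<Rightarrow> 'e \<Rightarrow> 'e \<Rightarrow> real) \<Rightarrow> bool" where
  "kenmotsu A \<phi> \<xi> \<eta> g \<longleftrightarrow> almost_contact_metric A \<phi> \<xi> \<eta> g \<and>
     (\<exists>D. is_levi_civita A g D \<and>
       (\<forall>X Y p. vector_field A X \<longrightarrow> vector_field A Y \<longrightarrow>
          D X (\<lambda>q. \<phi> q (Y q)) p - \<phi> p (D X Y p)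
            = g p (\<phi> p (X p)) (Y p) *\<^sub>R \<xi> p - \<eta> p (Y p) *\<^sub>R \<phi> p (X p)))"

definition D_homothetic ::
    "real \<Rightarrow>
     ('m \<Rightarrow> 'e \<Rightarrow> 'e) \<times> ('m \<Rightarrow> 'e::euclidean_space) \<times> ('m \<Rightarrow> 'e \<Rightarrow> real) \<times> ('m \<Rightarrow> 'e \<Rightarrow> 'e \<Rightarrow> real) \<Rightarrow>
     ('m \<Rightarrow> 'e \<Rightarrow> 'e) \<times> ('m \<Rightarrow> 'e) \<times> ('m \<Rightarrow> 'e \<Rightarrow> real) \<times> ('m \<Rightarrow> 'e \<Rightarrow> 'e \<Rightarrow> real)" where
  "D_homothetic a = (\<lambda>(\<phi>, \<xi>, \<eta>, g).
     (\<phi>, \<lambda>p. (1 / a) *\<^sub>R \<xi> p, \<lambda>p v. a * \<eta> p v,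
      \<lambda>p v w. a * g p v w + a * (a - 1) * (\<eta> p v * \<eta> p w)))"

definition almost_ricci_soliton ::
    "('m, 'e::euclidean_space) chart set \<Rightarrow> ('m \<Rightarrow> 'e \<Rightarrow> 'e \<Rightarrow> real) \<Rightarrow>
     ('m \<Rightarrow> 'e) \<Rightarrow> ('m \<Rightarrow> real) \<Rightarrow> bool" where
  "almost_ricci_soliton A h V lam \<longleftrightarrow>
     vector_field A V \<and> (\<forall>p. V p \<noteq> 0) \<and> smooth_function A lam \<and>
     (\<forall>X Y p. vector_field A X \<longrightarrow> vector_field A Y \<longrightarrow>
        1 / 2 * lie_derivative_metric A V h X Y p + ricci A h X Y p = lam p * h p (X p) (Y p))"

definition gradient_almost_ricci_soliton ::
    "('m, 'e::euclidean_space) chart set \<Rightarrow> ('m \<Rightarrow> 'e \<Rightarrow> 'e \<Rightarrow> real) \<Rightarrow>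
     ('m \<Rightarrow> 'e) \<Rightarrow> ('m \<Rightarrow> real) \<Rightarrow> bool" where
  "gradient_almost_ricci_soliton A h V lam \<longleftrightarrow> almost_ricci_soliton A h V lam \<and>
     (\<exists>u. smooth_function A u \<and> V = gradient A h u)"

end

theory Submission
  imports Defs
begin

text \<open>
  Everything is read off from the soliton equation at the pair \<open>(\<xi>, \<xi>)\<close>, which needs three numbers:
  \<open>g'(\<xi>, \<xi>)\<close>, \<open>Ric'(\<xi>, \<xi>)\<close> and \<open>L\<^sub>V g' (\<xi>, \<xi>)\<close>. Here and below a prime marks what
  belongs to the deformed metric \<open>g' = a g + a (a - 1) \<eta> \<otimes> \<eta>\<close>.

  The Kenmotsu condition applied to \<open>Y = \<xi>\<close> gives \<open>D\<^sub>X \<xi> = X - \<eta>(X) \<xi>\<close> (lemma \<open>D_xi\<close>). The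
  connection \<open>D'\<^sub>X Y = D\<^sub>X Y + (a - 1) / a (g(X, Y) - \<eta>(X) \<eta>(Y)) \<xi>\<close> is torsion free and
  compatible with \<open>g'\<close> (lemma \<open>is_levi_civita_D'\<close>), so it is the Levi-Civita connection of \<open>g'\<close>;
  and its correction term vanishes when one argument is \<open>\<xi>\<close>, so that again
  \<open>D'\<^sub>X \<xi> = X - \<eta>(X) \<xi>\<close>.

  This formula yields \<open>R'(X, \<xi>) \<xi> = \<eta>(X) \<xi> - X\<close> (lemma \<open>curvature_xi_xi\<close>), whose trace over \<open>X\<close>
  is \<open>Ric'(\<xi>, \<xi>) = 1 - (2 n + 1) = - 2 n\<close>. Also \<open>D'\<^sub>\<xi> \<xi> = 0\<close> and \<open>g'(\<xi>, \<xi>) = a\<^sup>2\<close>, so that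
  \<open>L\<^sub>V g' (\<xi>, \<xi>) / 2 = g'(D'\<^sub>\<xi> V, \<xi>) = \<xi> (g'(V, \<xi>)) = \<xi> (\<xi> f)\<close> for \<open>V = grad' f\<close>
  (lemma \<open>lie_derivative_gradient_xi_xi\<close>). Finally \<open>\<xi> (\<xi> f)\<close> is \<open>Hess(f)(\<xi>, \<xi>)\<close> because
  \<open>D\<^sub>\<xi> \<xi> = 0\<close>, and the soliton equation reads
  \<open>Hess(f)(\<xi>, \<xi>) - 2 n = \<lambda> a\<^sup>2\<close>.

  What this computation takes for granted has to be built first. Sums, products and compositions of
  smooth maps must be smooth for the new connection to map smooth fields to smooth fields. And the
  Ricci tensor is a trace over global vector fields with prescribed value at a point, whose
  existence rests on a bump function (lemma \<open>ex_vector_field_through\<close>).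
\<close>

section \<open>Calculus of smooth maps\<close>

lemma frechet_derivative_eqI:
  "(f has_derivative f') (at x) \<Longrightarrow> frechet_derivative f (at x) v = f' v"
  by (metis frechet_derivative_at)

lemma has_frechet_derivative:
  "f differentiable (at x) \<Longrightarrow> (f has_derivative frechet_derivative f (at x)) (at x)"
  using frechet_derivative_works by blast

text \<open>
  On an open set the derivatives of all orders depend only on the values there. This makes it
  possible to replace a map by its formula in coordinates, which is valid only inside a chart.
\<close>

lemma times_differentiable_on_cong_imp:
  assumes "open S" "\<And>x. x \<in> S \<Longrightarrow> f x = g x" "times_differentiable_on k S f"
  shows "times_differentiable_on k S g"
  using assms
proof (induction k arbitrary: f g)
  case 0
  then show ?case using continuous_on_cong by force
next
  case (Suc k)
  have der: "(g has_derivative frechet_derivative f (at x)) (at x)" if "x \<in> S" for x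
    using has_derivative_transform_within_open[OF has_frechet_derivative Suc.prems(1) that] Suc.prems that
    by auto
  have "times_differentiable_on k S (\<lambda>x. frechet_derivative g (at x) v)" for v
    using Suc.IH[of "\<lambda>x. frechet_derivative f (at x) v" "\<lambda>x. frechet_derivative g (at x) v"]
      Suc.prems frechet_derivative_eqI[OF der] by auto
  then show ?case using der by (auto simp: differentiable_def)
qed

text \<open>Hides the choice operator in \<open>frechet_derivative\<close>: any formula for the derivative will do.\<close>

lemma times_differentiable_on_SucI:
  assumes "open S" "\<And>x. x \<in> S \<Longrightarrow> (f has_derivative f' x) (at x)"
    and "\<And>v. times_differentiable_on k S (\<lambda>x. f' x v)"
  shows "times_differentiable_on (Suc k) S f"
proof -
  have "times_differentiable_on k S (\<lambda>x. frechet_derivative f (at x) v)" for v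
    by (rule times_differentiable_on_cong_imp[OF assms(1) _ assms(3)[of v]])
      (rule frechet_derivative_eqI[OF assms(2), symmetric])
  then show ?thesis using assms(2) by (auto simp: differentiable_def)
qed

lemma times_differentiable_on_Suc_imp:
  "times_differentiable_on (Suc k) S f \<Longrightarrow> times_differentiable_on k S f"
proof (induction k arbitrary: f)
  case 0
  then show ?case
    by (simp add: continuous_at_imp_continuous_on differentiable_imp_continuous_within)
next
  case (Suc k)
  then show ?case by (metis times_differentiable_on.simps(2))
qed

text \<open>
  Smoothness can be checked on an open cover; a vector field cut off by a bump function is smooth
  for different reasons near its support and away from it.
\<close>

lemma times_differentiable_on_local:
  assumes "\<And>x. x \<in> S \<Longrightarrow> \<exists>U. open U \<and> x \<in> U \<and> times_differentiable_on k U f"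
  shows "times_differentiable_on k S f"
  using assms
proof (induction k arbitrary: f)
  case 0
  then have "isCont f x" if "x \<in> S" for x
    using that continuous_on_eq_continuous_at by (metis times_differentiable_on.simps(1))
  then show ?case by (simp add: continuous_at_imp_continuous_on)
next
  case (Suc k)
  then show ?case by (metis times_differentiable_on.simps(2))
qed

lemma times_differentiable_on_const: "times_differentiable_on k S (\<lambda>x. c)"
  by (induction k arbitrary: c) auto

lemma times_differentiable_on_bounded_linear:
  assumes "open S" "bounded_linear f"
  shows "times_differentiable_on k S f"
proof (cases k)
  case 0
  then show ?thesis using assms by (simp add: linear_continuous_on)
next
  case (Suc j)
  show ?thesis unfolding Suc
    using times_differentiable_on_SucI[OF assms(1), of f "\<lambda>x. f"]
      bounded_linear_imp_has_derivative[OF assms(2)] times_differentiable_on_const by blast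
qed

lemma times_differentiable_on_add:
  assumes "open S" "times_differentiable_on k S f" "times_differentiable_on k S g"
  shows "times_differentiable_on k S (\<lambda>x. f x + g x)"
  using assms(2,3)
proof (induction k arbitrary: f g)
  case 0
  then show ?case by (auto intro: continuous_on_add)
next
  case (Suc k)
  show ?case
  proof (rule times_differentiable_on_SucI[OF assms(1)])
    fix x assume "x \<in> S"
    then show "((\<lambda>x. f x + g x) has_derivative
        (\<lambda>v. frechet_derivative f (at x) v + frechet_derivative g (at x) v)) (at x)"
      using Suc.prems by (intro has_derivative_add has_frechet_derivative) auto
  next
    show "times_differentiable_on k S
        (\<lambda>x. frechet_derivative f (at x) v + frechet_derivative g (at x) v)" for v
      using Suc by auto
  qed
qed

text \<open>
  By the Leibniz rule the derivative is a sum of two products of maps that are one time less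
  differentiable, so the induction closes. Ordinary products, inner products and scalar multiples are
  all instances.
\<close>

lemma times_differentiable_on_bilinear:
  assumes "bounded_bilinear B"
    and "open S" "times_differentiable_on k S f" "times_differentiable_on k S g"
  shows "times_differentiable_on k S (\<lambda>x. B (f x) (g x))"
  using assms(3,4)
proof (induction k arbitrary: f g)
  case 0
  then show ?case using bounded_bilinear.continuous_on[OF assms(1)] by auto
next
  case (Suc k)
  show ?case
  proof (rule times_differentiable_on_SucI[OF assms(2)])
    fix x assume "x \<in> S"
    then show "((\<lambda>x. B (f x) (g x)) has_derivative
        (\<lambda>v. B (f x) (frechet_derivative g (at x) v) + B (frechet_derivative f (at x) v) (g x))) (at x)"
      using Suc.prems
      by (intro bounded_bilinear.FDERIV[OF assms(1)] has_frechet_derivative) auto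
  next
    fix v
    have "times_differentiable_on k S f" "times_differentiable_on k S g"
      using Suc.prems times_differentiable_on_Suc_imp by blast+
    moreover have "times_differentiable_on k S (\<lambda>x. frechet_derivative f (at x) v)"
      "times_differentiable_on k S (\<lambda>x. frechet_derivative g (at x) v)"
      using Suc.prems by simp_all
    ultimately show "times_differentiable_on k S (\<lambda>x. B (f x) (frechet_derivative g (at x) v)
        + B (frechet_derivative f (at x) v) (g x))"
      by (intro times_differentiable_on_add[OF assms(2)] Suc.IH)
  qed
qed

lemma times_differentiable_on_sum:
  assumes "open S" "\<And>i. i \<in> I \<Longrightarrow> times_differentiable_on k S (f i)"
  shows "times_differentiable_on k S (\<lambda>x. \<Sum>i\<in>I. f i x)"
  using assms(2)
proof (induction I rule: infinite_finite_induct)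
  case (insert i I)
  then show ?case
    using times_differentiable_on_add[OF assms(1), of k "f i" "\<lambda>x. \<Sum>i\<in>I. f i x"] by simp
qed (simp_all add: times_differentiable_on_const)

text \<open>
  Expanding \<open>Dg(x) v\<close> in the standard basis turns the chain rule into
  \<open>D(f \<circ> g)(x) v = \<Sum>\<^sub>i (Dg(x) v \<bullet> i) Df(g x) i\<close>. Each \<open>Df i\<close> is then a fixed map composed with \<open>g\<close>, to
  which the induction hypothesis applies.
\<close>

lemma times_differentiable_on_compose:
  fixes f :: "'b::euclidean_space \<Rightarrow> 'c::real_normed_vector"
    and g :: "'a::real_normed_vector \<Rightarrow> 'b"
  assumes "open S" "g ` S \<subseteq> T" "times_differentiable_on k T f" "times_differentiable_on k S g"
  shows "times_differentiable_on k S (\<lambda>x. f (g x))"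
  using assms(3,4)
proof (induction k arbitrary: f)
  case 0
  then show ?case using continuous_on_compose2 assms(2) by fastforce
next
  case (Suc k)
  show ?case
  proof (rule times_differentiable_on_SucI[OF assms(1)])
    fix x assume x: "x \<in> S"
    let ?Df = "frechet_derivative f (at (g x))" and ?Dg = "frechet_derivative g (at x)"
    have df: "(f has_derivative ?Df) (at (g x))"
      using x Suc.prems assms(2) by (intro has_frechet_derivative) auto
    have dg: "(g has_derivative ?Dg) (at x)"
      using x Suc.prems by (intro has_frechet_derivative) auto
    have "?Df (?Dg v) = (\<Sum>i\<in>Basis. (?Dg v \<bullet> i) *\<^sub>R ?Df i)" for v
    proof -
      have "?Df (\<Sum>i\<in>Basis. (?Dg v \<bullet> i) *\<^sub>R i) = (\<Sum>i\<in>Basis. (?Dg v \<bullet> i) *\<^sub>R ?Df i)"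
        using has_derivative_linear[OF df] by (simp add: linear_sum linear_cmul)
      then show ?thesis by (simp add: euclidean_representation)
    qed
    then show "((\<lambda>x. f (g x)) has_derivative (\<lambda>v. \<Sum>i\<in>Basis. (?Dg v \<bullet> i) *\<^sub>R ?Df i)) (at x)"
      using has_derivative_compose[OF dg df] by simp
  next
    fix v
    have g: "times_differentiable_on k S g" using Suc.prems(2) by (rule times_differentiable_on_Suc_imp)
    show "times_differentiable_on k S
        (\<lambda>x. \<Sum>i\<in>Basis. (frechet_derivative g (at x) v \<bullet> i) *\<^sub>R frechet_derivative f (at (g x)) i)"
      using Suc.prems
      by (intro times_differentiable_on_sum times_differentiable_on_bilinear[OF bounded_bilinear_scaleR]
          times_differentiable_on_bilinear[OF bounded_bilinear_inner] times_differentiable_on_const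
          Suc.IH g assms(1)) auto
  qed
qed

section \<open>A smooth bump function\<close>

text \<open>
  The functions \<open>t\<^sup>-\<^sup>n exp(- 1 / t)\<close>, continued by \<open>0\<close>. All exponents \<open>n\<close> are considered together because
  the derivative of one of them is a linear combination of two others; smoothness of the
  standard flat function \<open>flat 0\<close> then follows by a single induction.
\<close>

definition flat :: "nat \<Rightarrow> real \<Rightarrow> real" where
  "flat n t = (if t > 0 then exp (- (1 / t)) / t ^ n else 0)"

lemma flat_tendsto_0: "(flat n \<longlongrightarrow> 0) (at 0)"
proof -
  have "((\<lambda>t::real. exp (- (1 / t)) / t ^ n) \<longlongrightarrow> 0) (at_right 0)"
  proof -
    have "((\<lambda>u::real. u ^ n / exp u) \<longlongrightarrow> 0) at_top" by (rule tendsto_power_div_exp_0)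
    then have "((\<lambda>t::real. inverse t ^ n / exp (inverse t)) \<longlongrightarrow> 0) (at_right 0)"
      by (rule filterlim_compose[OF _ filterlim_inverse_at_top_right])
    then show ?thesis by (simp add: exp_minus field_simps power_inverse inverse_eq_divide)
  qed
  then have r: "(flat n \<longlongrightarrow> 0) (at_right 0)"
    by (rule Lim_transform_eventually) (auto simp: flat_def eventually_at_filter)
  have l: "(flat n \<longlongrightarrow> 0) (at_left 0)"
    by (rule Lim_transform_eventually[OF tendsto_const]) (auto simp: flat_def eventually_at_filter)
  show ?thesis using l r by (simp add: filterlim_split_at)
qed

lemma flat_has_derivative:
  "(flat n has_real_derivative flat (n + 2) t - real n * flat (n + 1) t) (at t)"
proof -
  consider "t > 0" | "t < 0" | "t = 0" by linarith
  then show ?thesis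
  proof cases
    case 1
    have "((\<lambda>t. exp (- (1 / t))) has_real_derivative exp (- (1 / t)) / t\<^sup>2) (at t)"
      using 1 by (auto intro!: derivative_eq_intros simp: power2_eq_square)
    moreover have "((\<lambda>t. t ^ n) has_real_derivative real n * t ^ n / t) (at t)"
      using DERIV_pow[of n t] 1 by (cases n) auto
    ultimately have "((\<lambda>t. exp (- (1 / t)) / t ^ n) has_real_derivative
        (exp (- (1 / t)) / t\<^sup>2 * t ^ n - exp (- (1 / t)) * (real n * t ^ n / t)) / (t ^ n * t ^ n)) (at t)"
      using 1 by (intro DERIV_divide) auto
    also have "(exp (- (1 / t)) / t\<^sup>2 * t ^ n - exp (- (1 / t)) * (real n * t ^ n / t)) / (t ^ n * t ^ n)
        = flat (n + 2) t - real n * flat (n + 1) t"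
      using 1 by (simp add: flat_def divide_simps power_add power2_eq_square) (simp add: algebra_simps)
    finally have "((\<lambda>t. exp (- (1 / t)) / t ^ n) has_real_derivative
        flat (n + 2) t - real n * flat (n + 1) t) (at t)" .
    then show ?thesis
      by (rule has_field_derivative_transform_within_open[where S = "{0<..}"]) (use 1 in \<open>auto simp: flat_def\<close>)
  next
    case 2
    have "((\<lambda>t. 0) has_real_derivative flat (n + 2) t - real n * flat (n + 1) t) (at t)"
      using 2 by (auto simp: flat_def)
    then show ?thesis
      by (rule has_field_derivative_transform_within_open[where S = "{..<0}"]) (use 2 in \<open>auto simp: flat_def\<close>)
  next
    case 3
    \<comment> \<open>the difference quotient of \<open>flat n\<close> at \<open>0\<close> is \<open>flat (n + 1)\<close>\<close>
    have "((\<lambda>h. (flat n (0 + h) - flat n 0) / h) \<longlongrightarrow> 0) (at 0)"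
      by (rule Lim_transform_eventually[OF flat_tendsto_0[of "Suc n"]])
        (auto simp: flat_def eventually_at_filter)
    then show ?thesis using 3 by (simp add: DERIV_def flat_def)
  qed
qed

lemma times_differentiable_on_flat: "times_differentiable_on k UNIV (flat n)"
proof (induction k arbitrary: n)
  case 0
  show ?case using flat_has_derivative by (auto intro!: continuous_at_imp_continuous_on DERIV_isCont)
next
  case (Suc k)
  show ?case
  proof (rule times_differentiable_on_SucI)
    show "(flat n has_derivative (\<lambda>v. (flat (n + 2) t + (- real n) * flat (n + 1) t) * v)) (at t)" for t
      using flat_has_derivative[of n t] by (simp add: has_field_derivative_def)
    show "times_differentiable_on k UNIV (\<lambda>t. (flat (n + 2) t + (- real n) * flat (n + 1) t) * v)" for v
      by (intro times_differentiable_on_bilinear[OF bounded_bilinear_mult] times_differentiable_on_add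
          times_differentiable_on_const Suc.IH open_UNIV)
  qed auto
qed

text \<open>
  The composition of \<open>flat 0\<close> with \<open>r\<^sup>2 - \<bar>x - x0\<bar>\<^sup>2\<close>, normalised at \<open>x0\<close>. The square of the norm is
  used as it is smooth also at the centre.
\<close>

lemma ex_bump:
  fixes x0 :: "'a::euclidean_space"
  assumes "r > 0"
  obtains \<rho> :: "'a \<Rightarrow> real" where "\<And>S. open S \<Longrightarrow> smooth_on S \<rho>" "\<rho> x0 = 1" "\<And>x. x \<notin> cball x0 r \<Longrightarrow> \<rho> x = 0"
proof
  \<comment> \<open>only sums and products occur, in the form covered by the closure rules\<close>
  let ?q = "\<lambda>x::'a. r\<^sup>2 + (- 1) * ((x + (- x0)) \<bullet> (x + (- x0)))"
  define \<rho> where "\<rho> x = (1 / flat 0 (r\<^sup>2)) * flat 0 (?q x)" for x :: 'a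
  show "smooth_on S \<rho>" if "open S" for S
    unfolding smooth_on_def \<rho>_def
    by (intro allI times_differentiable_on_bilinear[OF bounded_bilinear_mult]
        times_differentiable_on_bilinear[OF bounded_bilinear_inner] times_differentiable_on_const
        times_differentiable_on_compose[OF _ _ times_differentiable_on_flat] times_differentiable_on_add
        times_differentiable_on_bounded_linear bounded_linear_ident that) auto
  show "\<rho> x0 = 1" using assms by (simp add: \<rho>_def flat_def)
  show "\<rho> x = 0" if "x \<notin> cball x0 r" for x
  proof -
    have "norm (x - x0) \<ge> r" using that by (simp add: dist_norm norm_minus_commute)
    then have "r\<^sup>2 \<le> (norm (x - x0))\<^sup>2" using assms by (intro power_mono) auto
    then show ?thesis by (simp add: \<rho>_def flat_def power2_norm_eq_inner)
  qed
qed

section \<open>Charts, smooth functions and vector fields\<close>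

lemma smooth_on_cong: "open S \<Longrightarrow> (\<And>x. x \<in> S \<Longrightarrow> f x = g x) \<Longrightarrow> smooth_on S f \<Longrightarrow> smooth_on S g"
  unfolding smooth_on_def using times_differentiable_on_cong_imp by metis

lemma smooth_on_local:
  assumes "\<And>x. x \<in> S \<Longrightarrow> \<exists>U. open U \<and> x \<in> U \<and> smooth_on U f"
  shows "smooth_on S f"
  unfolding smooth_on_def
proof
  show "times_differentiable_on k S f" for k
    by (rule times_differentiable_on_local) (use assms in \<open>auto simp: smooth_on_def\<close>)
qed

lemma smooth_on_frechet_derivative:
  "smooth_on S f \<Longrightarrow> smooth_on S (\<lambda>x. frechet_derivative f (at x) v)"
  unfolding smooth_on_def by (metis times_differentiable_on.simps(2))

lemma smooth_on_imp_differentiable: "smooth_on S f \<Longrightarrow> x \<in> S \<Longrightarrow> f differentiable (at x)"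
  unfolding smooth_on_def by (metis times_differentiable_on.simps(2))

locale smooth_manifold =
  fixes A :: "('m::{t2_space,second_countable_topology}, 'e::euclidean_space) chart set"
  assumes atlas: "smooth_atlas A"
begin

lemma chart_at_in: "chart_at A p \<in> A" and in_chart_at: "p \<in> fst (chart_at A p)"
proof -
  have "\<exists>c. c \<in> A \<and> p \<in> fst c" using atlas unfolding smooth_atlas_def by (metis UN_iff UNIV_I)
  then have "chart_at A p \<in> A \<and> p \<in> fst (chart_at A p)"
    unfolding chart_at_def by (rule someI_ex)
  then show "chart_at A p \<in> A" "p \<in> fst (chart_at A p)" by auto
qed

context
  fixes c assumes c: "c \<in> A"
begin

lemma chart_homeomorphism: "homeomorphism (fst c) (chart_image c) (snd c) (chart_inv c)"
  and open_chart_domain: "open (fst c)"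
  and open_chart_image: "open (chart_image c)"
  using atlas c by (auto simp: smooth_atlas_def is_chart_def)

lemma chart_inv_coord: "p \<in> fst c \<Longrightarrow> chart_inv c (snd c p) = p"
  using chart_homeomorphism by (simp add: homeomorphism_def)

lemma coord_in_chart_image: "p \<in> fst c \<Longrightarrow> snd c p \<in> chart_image c"
  by (simp add: chart_image_def)

lemma coord_chart_inv: "x \<in> chart_image c \<Longrightarrow> snd c (chart_inv c x) = x"
  and chart_inv_in_domain: "x \<in> chart_image c \<Longrightarrow> chart_inv c x \<in> fst c"
  using chart_homeomorphism by (auto simp: homeomorphism_def)

lemma open_coord_image:
  assumes "open U" shows "open (snd c ` (fst c \<inter> U))"
proof -
  have "snd c ` (fst c \<inter> U) = chart_image c \<inter> chart_inv c -` U"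
  proof
    show "snd c ` (fst c \<inter> U) \<subseteq> chart_image c \<inter> chart_inv c -` U"
      using chart_inv_coord coord_in_chart_image by auto
    show "chart_image c \<inter> chart_inv c -` U \<subseteq> snd c ` (fst c \<inter> U)"
      using coord_chart_inv chart_inv_in_domain by (force simp: image_iff)
  qed
  moreover have "continuous_on (chart_image c) (chart_inv c)"
    using chart_homeomorphism by (simp add: homeomorphism_def)
  ultimately show ?thesis
    using continuous_open_preimage[OF _ open_chart_image assms] by simp
qed

end

lemma smooth_transition:
  "c \<in> A \<Longrightarrow> d \<in> A \<Longrightarrow> smooth_on (snd c ` (fst c \<inter> fst d)) (snd d \<circ> chart_inv c)"
  using atlas by (simp add: smooth_atlas_def)

lemma transition_has_derivative:
  assumes "c \<in> A" "d \<in> A" "p \<in> fst c" "p \<in> fst d"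
  shows "((snd d \<circ> chart_inv c) has_derivative
    frechet_derivative (snd d \<circ> chart_inv c) (at (snd c p))) (at (snd c p))"
  using assms smooth_transition[of c d]
  by (intro has_frechet_derivative smooth_on_imp_differentiable[of "snd c ` (fst c \<inter> fst d)"]) auto

text \<open>
  Tangent vectors transform consistently: passing through a third chart makes no difference. This is
  what makes a vector field given by a formula in one chart a well-defined object in all of them.
\<close>

lemma transition_chain_rule:
  assumes "c \<in> A" "d \<in> A" "e \<in> A" "p \<in> fst c" "p \<in> fst d" "p \<in> fst e"
  shows "frechet_derivative (snd e \<circ> chart_inv d) (at (snd d p))
      (frechet_derivative (snd d \<circ> chart_inv c) (at (snd c p)) v)
    = frechet_derivative (snd e \<circ> chart_inv c) (at (snd c p)) v"
proof -
  let ?F = "frechet_derivative (snd e \<circ> chart_inv d) (at (snd d p))"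
    and ?G = "frechet_derivative (snd d \<circ> chart_inv c) (at (snd c p))"
  have "((\<lambda>x. (snd e \<circ> chart_inv d) ((snd d \<circ> chart_inv c) x)) has_derivative (\<lambda>v. ?F (?G v))) (at (snd c p))"
    by (rule has_derivative_compose[OF transition_has_derivative[OF assms(1,2,4,5)]])
      (use transition_has_derivative[OF assms(2,3,5,6)] in \<open>simp add: chart_inv_coord[OF assms(1,4)] comp_def\<close>)
  then have "((snd e \<circ> chart_inv c) has_derivative (\<lambda>v. ?F (?G v))) (at (snd c p))"
    by (rule has_derivative_transform_within_open[where s = "snd c ` (fst c \<inter> fst d)"])
      (use assms in \<open>auto simp: chart_inv_coord intro!: open_coord_image open_chart_domain\<close>)
  then show ?thesis by (rule frechet_derivative_eqI[symmetric])
qed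

lemma transition_self:
  assumes "c \<in> A" "p \<in> fst c"
  shows "frechet_derivative (snd c \<circ> chart_inv c) (at (snd c p)) v = v"
proof (rule frechet_derivative_eqI)
  have "((\<lambda>x. x) has_derivative (\<lambda>x. x)) (at (snd c p))" by (rule has_derivative_ident)
  then show "((snd c \<circ> chart_inv c) has_derivative (\<lambda>x. x)) (at (snd c p))"
    by (rule has_derivative_transform_within_open[where s = "chart_image c"])
      (use assms in \<open>auto simp: coord_chart_inv open_chart_image coord_in_chart_image\<close>)
qed

lemma linear_tangent_coord:
  assumes "c \<in> A" "p \<in> fst c" shows "linear (tangent_coord A c p)"
  using has_derivative_linear[OF transition_has_derivative[OF chart_at_in assms(1) in_chart_at assms(2)]]
  by (simp add: tangent_coord_def[abs_def])

lemma smooth_function_const: "smooth_function A (\<lambda>p. k)"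
  by (simp add: smooth_function_def smooth_on_def comp_def times_differentiable_on_const)

lemma smooth_function_add:
  "smooth_function A f \<Longrightarrow> smooth_function A h \<Longrightarrow> smooth_function A (\<lambda>p. f p + h p)"
  using open_chart_image
  by (auto simp: smooth_function_def smooth_on_def comp_def intro!: times_differentiable_on_add)

lemma smooth_function_mult:
  "smooth_function A f \<Longrightarrow> smooth_function A h \<Longrightarrow> smooth_function A (\<lambda>p. f p * h p)"
  using open_chart_image
  by (auto simp: smooth_function_def smooth_on_def comp_def
      intro!: times_differentiable_on_bilinear[OF bounded_bilinear_mult])

lemma vector_field_add:
  assumes "vector_field A X" "vector_field A Y" shows "vector_field A (\<lambda>p. X p + Y p)"
  unfolding vector_field_def
proof
  fix c assume c: "c \<in> A"
  have "smooth_on (chart_image c) (\<lambda>x. coord_rep A c X x + coord_rep A c Y x)"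
    using assms c open_chart_image[OF c]
    by (auto simp: vector_field_def smooth_on_def intro!: times_differentiable_on_add)
  then show "smooth_on (chart_image c) (coord_rep A c (\<lambda>p. X p + Y p))"
    by (rule smooth_on_cong[OF open_chart_image[OF c], rotated])
      (use c in \<open>auto simp: coord_rep_def linear_add[OF linear_tangent_coord] chart_inv_in_domain\<close>)
qed

lemma vector_field_scaleR:
  assumes "smooth_function A f" "vector_field A X" shows "vector_field A (\<lambda>p. f p *\<^sub>R X p)"
  unfolding vector_field_def
proof
  fix c assume c: "c \<in> A"
  have "smooth_on (chart_image c) (\<lambda>x. f (chart_inv c x) *\<^sub>R coord_rep A c X x)"
    using assms c open_chart_image[OF c]
    by (auto simp: vector_field_def smooth_function_def smooth_on_def comp_def
        intro!: times_differentiable_on_bilinear[OF bounded_bilinear_scaleR])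
  then show "smooth_on (chart_image c) (coord_rep A c (\<lambda>p. f p *\<^sub>R X p))"
    by (rule smooth_on_cong[OF open_chart_image[OF c], rotated])
      (use c in \<open>auto simp: coord_rep_def linear_cmul[OF linear_tangent_coord] chart_inv_in_domain\<close>)
qed

lemma vector_field_diff:
  assumes "vector_field A X" "vector_field A Y" shows "vector_field A (\<lambda>p. X p - Y p)"
  using vector_field_add[OF assms(1) vector_field_scaleR[OF smooth_function_const[of "-1"] assms(2)]] by simp

lemma smooth_function_has_derivative:
  assumes "smooth_function A f"
  shows "((f \<circ> chart_inv (chart_at A p)) has_derivative differential A f p) (at (snd (chart_at A p) p))"
  unfolding differential_def[abs_def]
  using assms chart_at_in[of p] coord_in_chart_image[OF chart_at_in in_chart_at[of p]]
  by (intro has_frechet_derivative smooth_on_imp_differentiable[of "chart_image (chart_at A p)"])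
    (auto simp: smooth_function_def)

lemma linear_differential: "smooth_function A f \<Longrightarrow> linear (differential A f p)"
  by (rule has_derivative_linear[OF smooth_function_has_derivative])

lemma differential_eqI:
  "((\<lambda>x. f (chart_inv (chart_at A p) x)) has_derivative f') (at (snd (chart_at A p) p)) \<Longrightarrow> differential A f p v = f' v"
  unfolding differential_def comp_def by (rule frechet_derivative_eqI)

lemma deriv_along_const: "deriv_along A X (\<lambda>p. k) p = 0"
  unfolding deriv_along_def by (rule differential_eqI) (rule has_derivative_const)

lemma deriv_along_add:
  assumes "smooth_function A f" "smooth_function A h"
  shows "deriv_along A X (\<lambda>p. f p + h p) p = deriv_along A X f p + deriv_along A X h p"
  unfolding deriv_along_def
  by (rule differential_eqI)
    (intro has_derivative_add smooth_function_has_derivative[unfolded comp_def] assms)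

lemma deriv_along_mult:
  assumes "smooth_function A f" "smooth_function A h"
  shows "deriv_along A X (\<lambda>p. f p * h p) p = f p * deriv_along A X h p + deriv_along A X f p * h p"
proof -
  have "differential A (\<lambda>p. f p * h p) p v = f p * differential A h p v + differential A f p v * h p" for v
    using has_derivative_mult[OF assms[THEN smooth_function_has_derivative[unfolded comp_def, of _ p]]]
    by (rule differential_eqI[THEN trans]) (simp add: chart_inv_coord chart_at_in in_chart_at)
  then show ?thesis unfolding deriv_along_def .
qed

lemma deriv_along_cmult:
  assumes "smooth_function A f"
  shows "deriv_along A X (\<lambda>p. k * f p) p = k * deriv_along A X f p"
  using deriv_along_mult[OF smooth_function_const assms] by (simp add: deriv_along_const)

text \<open>
  In the chart \<open>d\<close>, this is the coordinate representation of the field that is the constant \<open>b\<close> times \<open>\<rho>\<close> in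
  the chart \<open>c\<close>.
\<close>

lemma smooth_pushforward_bump:
  assumes "c \<in> A" "d \<in> A" "\<And>S. open S \<Longrightarrow> smooth_on S \<rho>"
  shows "smooth_on (snd d ` (fst d \<inter> fst c))
    (\<lambda>x. \<rho> (snd c (chart_inv d x)) *\<^sub>R
      frechet_derivative (snd d \<circ> chart_inv c) (at (snd c (chart_inv d x))) b)"
proof -
  let ?S = "snd d ` (fst d \<inter> fst c)"
  have t: "times_differentiable_on k ?S (\<lambda>x. snd c (chart_inv d x))" for k
    using smooth_transition[OF assms(2,1)] by (simp add: smooth_on_def comp_def)
  have s: "times_differentiable_on k (snd c ` (fst c \<inter> fst d))
      (\<lambda>y. frechet_derivative (snd d \<circ> chart_inv c) (at y) b)" for k
    using smooth_on_frechet_derivative[OF smooth_transition[OF assms(1,2)]] by (simp add: smooth_on_def)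
  have \<rho>: "times_differentiable_on k UNIV \<rho>" for k using assms(3)[of UNIV] by (simp add: smooth_on_def)
  have o: "open ?S" by (intro open_coord_image open_chart_domain assms)
  have sub: "(\<lambda>x. snd c (chart_inv d x)) ` ?S \<subseteq> snd c ` (fst c \<inter> fst d)"
    using chart_inv_coord[OF assms(2)] by auto
  show ?thesis unfolding smooth_on_def
    by (intro allI times_differentiable_on_bilinear[OF bounded_bilinear_scaleR] o
        times_differentiable_on_compose[OF o sub s t] times_differentiable_on_compose[OF o _ \<rho> t]) auto
qed

text \<open>
  Take the field with constant coordinates \<open>v\<close> in the chosen chart around \<open>p\<close>, multiply it by a bump
  function supported in a small closed ball and extend it by zero. The preimage of that ball is compact, hence
  closed in the Hausdorff space \<open>'m\<close>, so its complement is an open set where the field vanishes and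
  which together with the chart domain covers the manifold.
\<close>

lemma ex_vector_field_through: "\<exists>X. vector_field A X \<and> X p = v"
proof -
  define c where "c = chart_at A p"
  define x0 where "x0 = snd c p"
  have c: "c \<in> A" and pc: "p \<in> fst c" by (simp_all add: c_def chart_at_in in_chart_at)
  have "x0 \<in> chart_image c" by (simp add: x0_def coord_in_chart_image[OF c pc])
  then obtain r where r: "r > 0" "cball x0 r \<subseteq> chart_image c"
    using open_chart_image[OF c] open_contains_cball by blast
  obtain \<rho> :: "'e \<Rightarrow> real" where \<rho>: "\<And>S. open S \<Longrightarrow> smooth_on S \<rho>" "\<rho> x0 = 1"
    "\<And>x. x \<notin> cball x0 r \<Longrightarrow> \<rho> x = 0"
    using ex_bump[OF r(1), of x0] by blast
  define X where "X q = (if q \<in> fst c then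
      \<rho> (snd c q) *\<^sub>R frechet_derivative (snd (chart_at A q) \<circ> chart_inv c) (at (snd c q)) v else 0)" for q
  define K where "K = chart_inv c ` cball x0 r"
  have "compact K" unfolding K_def
    by (intro compact_continuous_image continuous_on_subset[OF _ r(2)])
      (use chart_homeomorphism[OF c] in \<open>auto simp: homeomorphism_def\<close>)
  then have "open (- K)" by (simp add: compact_imp_closed open_Compl)
  \<comment> \<open>the arbitrary charts \<open>chart_at A q\<close> cancel from the representation in any fixed chart \<open>d\<close>\<close>
  have rep: "coord_rep A d X (snd d q) = (if q \<in> fst c then
      \<rho> (snd c q) *\<^sub>R frechet_derivative (snd d \<circ> chart_inv c) (at (snd c q)) v else 0)"
    if d: "d \<in> A" and q: "q \<in> fst d" for d q
  proof -
    note lin = has_derivative_linear[OF transition_has_derivative[OF chart_at_in d in_chart_at q]]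
    show ?thesis
      using transition_chain_rule[OF c chart_at_in d _ in_chart_at q]
      by (auto simp: coord_rep_def chart_inv_coord[OF d q] X_def tangent_coord_def
          linear_cmul[OF lin] linear_0[OF lin])
  qed
  have "vector_field A X" unfolding vector_field_def
  proof
    fix d assume d: "d \<in> A"
    show "smooth_on (chart_image d) (coord_rep A d X)"
    proof (rule smooth_on_local)
      fix x assume x: "x \<in> chart_image d"
      define q where "q = chart_inv d x"
      have q: "q \<in> fst d" "x = snd d q" using x d by (simp_all add: q_def chart_inv_in_domain coord_chart_inv)
      show "\<exists>U. open U \<and> x \<in> U \<and> smooth_on U (coord_rep A d X)"
      proof (cases "q \<in> fst c")
        case True
        have "smooth_on (snd d ` (fst d \<inter> fst c)) (coord_rep A d X)"
          by (rule smooth_on_cong[OF _ _ smooth_pushforward_bump[OF c d \<rho>(1)]])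
            (auto simp: rep[OF d] chart_inv_coord[OF d] intro: open_coord_image[OF d open_chart_domain[OF c]])
        then show ?thesis
          using open_coord_image[OF d open_chart_domain[OF c]] q True by blast
      next
        case False
        have "K \<subseteq> fst c" using r(2) chart_inv_in_domain[OF c] by (auto simp: K_def)
        have "coord_rep A d X (snd d s) = 0" if "s \<in> fst d" "s \<notin> K" for s
        proof (cases "s \<in> fst c")
          case True
          have "snd c s \<notin> cball x0 r"
            using that(2) chart_inv_coord[OF c True] by (metis K_def image_eqI)
          then show ?thesis using \<rho>(3) that by (simp add: rep[OF d])
        qed (simp add: rep[OF d that(1)])
        then have zero: "0 = coord_rep A d X y" if "y \<in> snd d ` (fst d \<inter> - K)" for y
          using that by auto
        have "smooth_on (snd d ` (fst d \<inter> - K)) (coord_rep A d X)"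
        proof (rule smooth_on_cong)
          show "smooth_on (snd d ` (fst d \<inter> - K)) (\<lambda>x. 0 :: 'e)"
            by (simp add: smooth_on_def times_differentiable_on_const)
        qed (use zero open_coord_image[OF d \<open>open (- K)\<close>] in auto)
        then show ?thesis
          using open_coord_image[OF d \<open>open (- K)\<close>] q False \<open>K \<subseteq> fst c\<close> by blast
      qed
    qed
  qed
  moreover have "X p = v"
    using transition_self[OF c pc] pc \<rho>(2) by (simp add: X_def x0_def c_def[symmetric])
  ultimately show ?thesis by blast
qed

lemma vector_field_extend_vector: "vector_field A (extend_vector A p v)"
  and extend_vector_at: "extend_vector A p v p = v"
  using someI_ex[OF ex_vector_field_through[of p v]] unfolding extend_vector_def by auto

end

section \<open>Metrics and their Levi-Civita connections\<close>

lemma riemannian_metric_bilinear: "riemannian_metric A h \<Longrightarrow> bilinear (h p)"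
  and riemannian_metric_sym: "riemannian_metric A h \<Longrightarrow> h p v w = h p w v"
  and riemannian_metric_pos: "riemannian_metric A h \<Longrightarrow> v \<noteq> 0 \<Longrightarrow> h p v v > 0"
  and smooth_function_metric: "riemannian_metric A h \<Longrightarrow> vector_field A X \<Longrightarrow> vector_field A Y \<Longrightarrow>
    smooth_function A (\<lambda>p. h p (X p) (Y p))"
  by (auto simp: riemannian_metric_def)

text \<open>
  Riesz representation for the inner product \<open>h p\<close>: its Gram map with respect to the standard basis is
  injective by definiteness, hence surjective. It gives the description in the definition of the
  gradient a meaning.
\<close>

lemma metric_representation:
  fixes A :: "('m, 'e::euclidean_space) chart set"
  assumes h: "riemannian_metric A h" and L: "linear L"
  shows "\<exists>!v. \<forall>w. h p v w = L w"
proof -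
  let ?T = "\<lambda>v. \<Sum>b\<in>Basis. h p v b *\<^sub>R b"
  note bil = riemannian_metric_bilinear[OF h, of p]
  have lin: "linear (h p v)" for v using bil by (simp add: bilinear_def)
  have T: "?T v \<bullet> w = h p v w" for v w
  proof -
    have "h p v w = h p v (\<Sum>b\<in>Basis. (w \<bullet> b) *\<^sub>R b)" by (simp add: euclidean_representation)
    also have "\<dots> = (\<Sum>b\<in>Basis. h p v b * (w \<bullet> b))"
      by (simp add: linear_sum[OF lin] linear_cmul[OF lin] mult.commute)
    finally show ?thesis by (simp add: inner_sum_left inner_commute[of w])
  qed
  have "linear ?T"
    by (rule linearI) (simp_all add: bilinear_ladd[OF bil] bilinear_lmul[OF bil]
        scaleR_add_left sum.distrib scaleR_sum_right)
  moreover have "v = 0" if "?T v = 0" for v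
    using riemannian_metric_pos[OF h, of v p] T[of v v] that by force
  ultimately have inj: "inj ?T" by (simp add: linear_injective_0)
  then have "surj ?T" using \<open>linear ?T\<close> linear_injective_imp_surjective by blast
  then obtain v where v: "(\<Sum>b\<in>Basis. L b *\<^sub>R b) = ?T v" by (rule surjE)
  have v_L: "h p v w = L w" for w
  proof -
    have "L w = L (\<Sum>b\<in>Basis. (w \<bullet> b) *\<^sub>R b)" by (simp add: euclidean_representation)
    also have "\<dots> = (\<Sum>b\<in>Basis. L b *\<^sub>R b) \<bullet> w"
      by (simp add: linear_sum[OF L] linear_cmul[OF L] inner_sum_left inner_commute[of w] mult.commute)
    finally show ?thesis using T[of v w] v by simp
  qed
  have "u = v" if "\<forall>w. h p u w = L w" for u
  proof (rule injD[OF inj])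
    show "?T u = ?T v" using that v_L by simp
  qed
  then show ?thesis using v_L by blast
qed

lemma
  assumes "affine_connection A D" "vector_field A X" "vector_field A Y"
  shows affine_connection_vector_field: "vector_field A (D X Y)"
    and affine_connection_add_left: "vector_field A Z \<Longrightarrow>
      D (\<lambda>p. X p + Y p) Z = (\<lambda>p. D X Z p + D Y Z p)"
    and affine_connection_add_right: "vector_field A Z \<Longrightarrow>
      D X (\<lambda>p. Y p + Z p) = (\<lambda>p. D X Y p + D X Z p)"
    and affine_connection_scaleR_left: "smooth_function A f \<Longrightarrow>
      D (\<lambda>p. f p *\<^sub>R X p) Y = (\<lambda>p. f p *\<^sub>R D X Y p)"
    and affine_connection_scaleR_right: "smooth_function A f \<Longrightarrow>
      D X (\<lambda>p. f p *\<^sub>R Y p) = (\<lambda>p. deriv_along A X f p *\<^sub>R Y p + f p *\<^sub>R D X Y p)"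
  using assms unfolding affine_connection_def by blast+

lemma
  assumes "is_levi_civita A h D"
  shows levi_civita_affine: "affine_connection A D"
    and levi_civita_torsion_free: "vector_field A X \<Longrightarrow> vector_field A Y \<Longrightarrow>
      lie_bracket A X Y p = D X Y p - D Y X p"
    and levi_civita_metric: "vector_field A X \<Longrightarrow> vector_field A Y \<Longrightarrow> vector_field A Z \<Longrightarrow>
      deriv_along A X (\<lambda>q. h q (Y q) (Z q)) p = h p (D X Y p) (Z p) + h p (Y p) (D X Z p)"
  using assms by (auto simp: is_levi_civita_def torsion_free_def metric_connection_def)

lemma is_levi_civita_levi_civita: "is_levi_civita A h D \<Longrightarrow> is_levi_civita A h (levi_civita A h)"
  unfolding levi_civita_def by (rule someI[of "is_levi_civita A h"])

context smooth_manifold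
begin

text \<open>
  The difference \<open>S\<close> of two such connections is symmetric by torsion freeness, while \<open>h(S(X, Y), Z)\<close> is
  skew in \<open>Y\<close> and \<open>Z\<close> by metric compatibility. Alternating these two symmetries six times gives
  \<open>h(S(X, Y), Z) = - h(S(X, Y), Z)\<close>; then take \<open>Z = S(X, Y)\<close>.
\<close>

lemma levi_civita_unique:
  assumes h: "riemannian_metric A h" and D: "is_levi_civita A h D" and E: "is_levi_civita A h E"
    and X: "vector_field A X" and Y: "vector_field A Y"
  shows "D X Y = E X Y"
proof
  fix p
  note bil = riemannian_metric_bilinear[OF h, of p]
  let ?S = "\<lambda>X Y q. D X Y q - E X Y q"
  let ?T = "\<lambda>X Y Z. h p (?S X Y p) (Z p)"
  have sym: "?T X Y Z = ?T Y X Z" if "vector_field A X" "vector_field A Y" for X Y Z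
    using levi_civita_torsion_free[OF D that, of p] levi_civita_torsion_free[OF E that, of p]
    by (metis (no_types, lifting) add_diff_cancel_left' add_diff_eq diff_add_cancel diff_diff_eq2)
  have skew: "?T X Y Z = - ?T X Z Y"
    if "vector_field A X" "vector_field A Y" "vector_field A Z" for X Y Z
    using levi_civita_metric[OF D that, of p] levi_civita_metric[OF E that, of p]
    by (simp add: bilinear_lsub[OF bil] riemannian_metric_sym[OF h, of p "Y p"])
  have S: "vector_field A (?S X Y)"
    by (intro vector_field_diff affine_connection_vector_field[OF levi_civita_affine[OF D]]
        affine_connection_vector_field[OF levi_civita_affine[OF E]] assms)
  have "?T X Y (?S X Y) = 0"
    using skew[OF X Y S] sym[OF X S, of Y] skew[OF S X Y] sym[OF S Y, of X] skew[OF Y S X]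
      sym[OF Y X, of "?S X Y"] by linarith
  then show "D X Y p = E X Y p"
    using riemannian_metric_pos[OF h, of "?S X Y p" p] by force
qed

lemma metric_gradient:
  assumes "riemannian_metric A h" "smooth_function A f"
  shows "h p (gradient A h f p) w = differential A f p w"
  using theI'[OF metric_representation[OF assms(1) linear_differential[OF assms(2)], of p p]]
  by (simp add: gradient_def)

lemma affine_connection_zero_right:
  assumes "affine_connection A D" "vector_field A X"
  shows "D X (\<lambda>p. 0) = (\<lambda>p. 0)"
  using affine_connection_scaleR_right[OF assms(1,2,2) smooth_function_const[of 0]]
  by (simp add: deriv_along_const)

end

section \<open>The Reeb field of a Kenmotsu manifold\<close>

locale kenmotsu_manifold = smooth_manifold A
  for A :: "('m::{t2_space,second_countable_topology}, 'e::euclidean_space) chart set" +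
  fixes \<phi> :: "'m \<Rightarrow> 'e \<Rightarrow> 'e" and \<xi> :: "'m \<Rightarrow> 'e" and \<eta> :: "'m \<Rightarrow> 'e \<Rightarrow> real"
    and g :: "'m \<Rightarrow> 'e \<Rightarrow> 'e \<Rightarrow> real"
  assumes kenmotsu: "kenmotsu A \<phi> \<xi> \<eta> g"
begin

abbreviation D :: "('m, 'e) connection" where "D \<equiv> levi_civita A g"

lemma metric: "riemannian_metric A g"
  and vector_field_xi: "vector_field A \<xi>"
  and vector_field_phi: "vector_field A X \<Longrightarrow> vector_field A (\<lambda>q. \<phi> q (X q))"
  and linear_phi: "linear (\<phi> p)"
  and linear_eta: "linear (\<eta> p)"
  and smooth_function_eta: "vector_field A X \<Longrightarrow> smooth_function A (\<lambda>p. \<eta> p (X p))"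
  and phi_phi: "\<phi> p (\<phi> p v) = - v + \<eta> p v *\<^sub>R \<xi> p"
  and eta_xi: "\<eta> p (\<xi> p) = 1"
  and eta_eq: "\<eta> p v = g p (\<xi> p) v"
  and g_phi_phi: "g p (\<phi> p v) (\<phi> p w) = g p v w - \<eta> p v * \<eta> p w"
  using kenmotsu
  by (auto simp: kenmotsu_def almost_contact_metric_def endomorphism_field_def one_form_def)

lemma g_bilinear: "bilinear (g p)"
  by (rule riemannian_metric_bilinear[OF metric])

lemma is_levi_civita_D: "is_levi_civita A g D"
  using kenmotsu is_levi_civita_levi_civita by (auto simp: kenmotsu_def)

lemmas D_affine = levi_civita_affine[OF is_levi_civita_D]
  and D_torsion_free = levi_civita_torsion_free[OF is_levi_civita_D]
  and D_metric = levi_civita_metric[OF is_levi_civita_D]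
  and vector_field_D = affine_connection_vector_field[OF levi_civita_affine[OF is_levi_civita_D]]

text \<open>
  The condition that defines a Kenmotsu manifold speaks of some Levi-Civita connection; by
  uniqueness it holds for the chosen one.
\<close>

lemma nabla_phi:
  assumes "vector_field A X" "vector_field A Y"
  shows "D X (\<lambda>q. \<phi> q (Y q)) p - \<phi> p (D X Y p)
    = g p (\<phi> p (X p)) (Y p) *\<^sub>R \<xi> p - \<eta> p (Y p) *\<^sub>R \<phi> p (X p)"
proof -
  obtain E where E: "is_levi_civita A g E" and
    "E X (\<lambda>q. \<phi> q (Y q)) p - \<phi> p (E X Y p)
      = g p (\<phi> p (X p)) (Y p) *\<^sub>R \<xi> p - \<eta> p (Y p) *\<^sub>R \<phi> p (X p)"
    using kenmotsu assms unfolding kenmotsu_def by blast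
  then show ?thesis
    using levi_civita_unique[OF metric is_levi_civita_D E] assms vector_field_phi by simp
qed

lemma xi_nonzero: "\<xi> p \<noteq> 0"
  using eta_xi[of p] linear_0[OF linear_eta[of p]] by auto

text \<open>\<open>\<phi> \<xi>\<close> has squared length \<open>g(\<xi>, \<xi>) - \<eta>(\<xi>)\<^sup>2 = 0\<close>.\<close>

lemma phi_xi: "\<phi> p (\<xi> p) = 0"
proof -
  have "g p (\<phi> p (\<xi> p)) (\<phi> p (\<xi> p)) = 0"
    by (simp add: g_phi_phi eta_xi flip: eta_eq)
  then show ?thesis using riemannian_metric_pos[OF metric, of "\<phi> p (\<xi> p)" p] by auto
qed

text \<open>Compare \<open>\<phi>\<^sup>2 (\<phi> v)\<close> with \<open>\<phi> (\<phi>\<^sup>2 v)\<close>.\<close>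

lemma eta_phi: "\<eta> p (\<phi> p v) = 0"
proof -
  have "\<phi> p (\<phi> p (\<phi> p v)) = - \<phi> p v"
    by (simp add: phi_phi[of p v] linear_diff[OF linear_phi]
        linear_cmul[OF linear_phi] phi_xi)
  then show ?thesis using phi_phi[of p "\<phi> p v"] xi_nonzero by simp
qed

text \<open>\<open>\<xi>\<close> has constant length.\<close>

lemma eta_D_xi:
  assumes "vector_field A X" shows "\<eta> p (D X \<xi> p) = 0"
  using D_metric[OF assms vector_field_xi vector_field_xi, of p] riemannian_metric_sym[OF metric, of p "\<xi> p"]
  by (simp add: deriv_along_const eta_xi flip: eta_eq)

text \<open>
  As \<open>\<phi> \<xi> = 0\<close>, the Kenmotsu condition with \<open>Y = \<xi>\<close> says \<open>\<phi> (D\<^sub>X \<xi>) = \<phi> X\<close>. The kernel of \<open>\<phi>\<close> is spanned by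
  \<open>\<xi>\<close>, so this determines \<open>D\<^sub>X \<xi>\<close> up to its component along \<open>\<xi>\<close>, which vanishes.
\<close>

lemma D_xi:
  assumes X: "vector_field A X"
  shows "D X \<xi> p = X p - \<eta> p (X p) *\<^sub>R \<xi> p"
proof -
  have "D X (\<lambda>q. 0) = (\<lambda>q. 0)" using affine_connection_zero_right[OF D_affine X] .
  moreover have "g p (\<phi> p (X p)) (\<xi> p) = 0"
    unfolding riemannian_metric_sym[OF metric, of p _ "\<xi> p"] eta_eq[symmetric] by (rule eta_phi)
  ultimately have "\<phi> p (D X \<xi> p) = \<phi> p (X p)"
    using nabla_phi[OF X vector_field_xi, of p] by (simp add: phi_xi eta_xi)
  then have "\<phi> p (\<phi> p (D X \<xi> p)) = \<phi> p (\<phi> p (X p))" by simp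
  then show ?thesis by (simp add: phi_phi eta_D_xi[OF X] algebra_simps)
qed

lemma deriv_along_eta:
  assumes "vector_field A X" "vector_field A Y"
  shows "deriv_along A X (\<lambda>q. \<eta> q (Y q)) p
    = \<eta> p (D X Y p) + (g p (X p) (Y p) - \<eta> p (X p) * \<eta> p (Y p))"
  using D_metric[OF assms(1) vector_field_xi assms(2), of p]
  by (simp add: D_xi[OF assms(1)] bilinear_lsub[OF g_bilinear] bilinear_lmul[OF g_bilinear] flip: eta_eq)

end

section \<open>The deformed metric and its Levi-Civita connection\<close>

locale deformed_kenmotsu_manifold = kenmotsu_manifold A \<phi> \<xi> \<eta> g
  for A :: "('m::{t2_space,second_countable_topology}, 'e::euclidean_space) chart set"
    and \<phi> \<xi> \<eta> g +
  fixes a :: real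
  assumes a_pos: "a > 0"
begin

definition g' :: "'m \<Rightarrow> 'e \<Rightarrow> 'e \<Rightarrow> real" where
  "g' p v w = a * g p v w + a * (a - 1) * (\<eta> p v * \<eta> p w)"

text \<open>
  By \<open>deriv_along_eta\<close>, the covariant derivative of \<open>g'\<close> with respect to \<open>D\<close> is
  \<open>a (a - 1) (d(X, Y) \<eta>(Z) + d(X, Z) \<eta>(Y))\<close> with the symmetric tensor \<open>d = g - \<eta> \<otimes> \<eta>\<close>. A correction
  \<open>k d(X, Y) \<xi>\<close> keeps the torsion zero and, as \<open>g'(\<xi>, Z) = a\<^sup>2 \<eta>(Z)\<close>, compensates this
  exactly when \<open>k a\<^sup>2 = a (a - 1)\<close>.
\<close>

definition D' :: "('m, 'e) connection" where
  "D' X Y p = D X Y p + ((a - 1) / a * (g p (X p) (Y p) + - 1 * (\<eta> p (X p) * \<eta> p (Y p)))) *\<^sub>R \<xi> p"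

lemmas tensor_simps = linear_add[OF linear_eta] linear_cmul[OF linear_eta] linear_diff[OF linear_eta]
  bilinear_ladd[OF g_bilinear] bilinear_radd[OF g_bilinear]
  bilinear_lmul[OF g_bilinear] bilinear_rmul[OF g_bilinear]

lemma g'_xi: "g' p v (\<xi> p) = a\<^sup>2 * \<eta> p v" "g' p (\<xi> p) v = a\<^sup>2 * \<eta> p v"
  using riemannian_metric_sym[OF metric, of p v "\<xi> p"]
  by (simp_all add: g'_def eta_xi power2_eq_square algebra_simps flip: eta_eq)

lemma riemannian_metric_g': "riemannian_metric A g'"
  unfolding riemannian_metric_def
proof (intro allI conjI impI)
  show "bilinear (g' p)" for p
    unfolding bilinear_def by (auto intro!: linearI simp: g'_def tensor_simps algebra_simps)
  show "g' p v w = g' p w v" for p v w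
    by (simp add: g'_def riemannian_metric_sym[OF metric, of p v w])
  show "g' p v v > 0" if "v \<noteq> 0" for p v
  proof -
    \<comment> \<open>\<open>g - \<eta> \<otimes> \<eta>\<close> is the pullback of \<open>g\<close> by \<open>\<phi>\<close>, hence nonnegative\<close>
    have 1: "g p v v - \<eta> p v * \<eta> p v \<ge> 0"
      using riemannian_metric_pos[OF metric, of "\<phi> p v" p] g_phi_phi[of p v v]
        bilinear_lzero[OF g_bilinear] by (cases "\<phi> p v = 0") auto
    have "g' p v v = a * (g p v v - \<eta> p v * \<eta> p v) + (a * \<eta> p v)\<^sup>2"
      by (simp add: g'_def power2_eq_square algebra_simps)
    moreover have "g p v v - \<eta> p v * \<eta> p v > 0" if "\<eta> p v = 0"
      using that riemannian_metric_pos[OF metric \<open>v \<noteq> 0\<close>] by simp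
    ultimately show ?thesis
      using 1 a_pos by (cases "\<eta> p v = 0") (auto intro: add_nonneg_pos)
  qed
  show "smooth_function A (\<lambda>p. g' p (X p) (Y p))" if "vector_field A X" "vector_field A Y" for X Y
    unfolding g'_def using that
    by (intro smooth_function_add smooth_function_mult smooth_function_const smooth_function_eta
        smooth_function_metric[OF metric])
qed

lemma affine_connection_D': "affine_connection A D'"
proof -
  \<comment> \<open>naming the coefficient keeps division out of the algebra\<close>
  define k where "k = (a - 1) / a"
  have D'_k: "D' = (\<lambda>X Y p. D X Y p + (k * (g p (X p) (Y p) + - 1 * (\<eta> p (X p) * \<eta> p (Y p)))) *\<^sub>R \<xi> p)"
    by (simp add: D'_def fun_eq_iff k_def)
  show ?thesis
    unfolding affine_connection_def
  proof (intro conjI allI impI)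
    fix X Y assume XY: "vector_field A X" "vector_field A Y"
    then show "vector_field A (D' X Y)"
      unfolding D'_k
      by (intro vector_field_add vector_field_scaleR vector_field_D vector_field_xi
          smooth_function_add smooth_function_mult smooth_function_const smooth_function_eta
          smooth_function_metric[OF metric])
    show "D' (\<lambda>p. X p + Y p) Z = (\<lambda>p. D' X Z p + D' Y Z p)"
      and "D' X (\<lambda>p. Y p + Z p) = (\<lambda>p. D' X Y p + D' X Z p)" if "vector_field A Z" for Z
      by (simp_all add: D'_k affine_connection_add_left[OF D_affine XY that]
          affine_connection_add_right[OF D_affine XY that] tensor_simps algebra_simps)
    show "D' (\<lambda>p. f p *\<^sub>R X p) Y = (\<lambda>p. f p *\<^sub>R D' X Y p)"
      and "D' X (\<lambda>p. f p *\<^sub>R Y p) = (\<lambda>p. deriv_along A X f p *\<^sub>R Y p + f p *\<^sub>R D' X Y p)"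
      if "smooth_function A f" for f
      by (simp_all add: D'_k affine_connection_scaleR_left[OF D_affine XY that]
          affine_connection_scaleR_right[OF D_affine XY that] tensor_simps algebra_simps)
  qed
qed

lemma is_levi_civita_D': "is_levi_civita A g' D'"
  unfolding is_levi_civita_def
proof (intro conjI affine_connection_D')
  show "torsion_free A D'"
    unfolding torsion_free_def
    by (simp add: D_torsion_free D'_def riemannian_metric_sym[OF metric] mult.commute)
  show "metric_connection A g' D'"
    unfolding metric_connection_def
  proof (intro allI impI)
    fix X Y Z p assume vf: "vector_field A X" "vector_field A Y" "vector_field A Z"
    let ?d = "\<lambda>Y. g p (X p) (Y p) - \<eta> p (X p) * \<eta> p (Y p)"
    have g'_D': "g' p (D' X Y p) (Z p) = g' p (D X Y p) (Z p) + a * (a - 1) * (?d Y * \<eta> p (Z p))" for Y Z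
    proof -
      have "g' p (D' X Y p) (Z p) = g' p (D X Y p) (Z p) + (a - 1) / a * ?d Y * g' p (\<xi> p) (Z p)"
        by (simp add: D'_def bilinear_ladd[OF riemannian_metric_bilinear[OF riemannian_metric_g']]
          bilinear_lmul[OF riemannian_metric_bilinear[OF riemannian_metric_g']])
      then show ?thesis using a_pos by (simp add: g'_xi power2_eq_square)
    qed
    have "deriv_along A X (\<lambda>q. g' q (Y q) (Z q)) p
      = a * (g p (D X Y p) (Z p) + g p (Y p) (D X Z p))
        + a * (a - 1) * (\<eta> p (Y p) * (\<eta> p (D X Z p) + ?d Z) + (\<eta> p (D X Y p) + ?d Y) * \<eta> p (Z p))"
      unfolding g'_def using vf
      by (simp add: deriv_along_add deriv_along_cmult deriv_along_mult smooth_function_mult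
          smooth_function_const smooth_function_eta smooth_function_metric[OF metric] D_metric deriv_along_eta)
    also have "\<dots> = g' p (D X Y p) (Z p) + a * (a - 1) * (?d Y * \<eta> p (Z p))
        + (g' p (D X Z p) (Y p) + a * (a - 1) * (?d Z * \<eta> p (Y p)))"
      unfolding g'_def riemannian_metric_sym[OF metric, of p "D X Z p" "Y p"] by (simp add: algebra_simps)
    also have "\<dots> = g' p (D' X Y p) (Z p) + g' p (Y p) (D' X Z p)"
      unfolding g'_D'[symmetric] riemannian_metric_sym[OF riemannian_metric_g', of p "Y p"] ..
    finally show "deriv_along A X (\<lambda>q. g' q (Y q) (Z q)) p
      = g' p (D' X Y p) (Z p) + g' p (Y p) (D' X Z p)" .
  qed
qed

lemma levi_civita_g':
  "vector_field A X \<Longrightarrow> vector_field A Y \<Longrightarrow> levi_civita A g' X Y = D' X Y"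
  by (rule levi_civita_unique[OF riemannian_metric_g'
        is_levi_civita_levi_civita[OF is_levi_civita_D'] is_levi_civita_D'])

lemma D'_xi: "vector_field A X \<Longrightarrow> D' X \<xi> = (\<lambda>p. X p + (- 1 * \<eta> p (X p)) *\<^sub>R \<xi> p)"
  using riemannian_metric_sym[OF metric]
  by (simp add: D'_def[abs_def] D_xi eta_xi eta_eq[symmetric] fun_eq_iff) (metis eta_eq)

lemma D'_xi_left: "D' \<xi> X p = D \<xi> X p"
  by (simp add: D'_def eta_xi flip: eta_eq)

section \<open>Ricci curvature and Lie derivative in the Reeb direction\<close>

text \<open>
  Since \<open>D'\<^sub>\<xi> \<xi> = 0\<close>, only \<open>- D'\<^sub>\<xi> (X - \<eta>(X) \<xi>)\<close> and \<open>- D'\<^sub>B \<xi> = - B + \<eta>(B) \<xi>\<close> with \<open>B = [X, \<xi>]\<close>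
  remain. Their \<open>\<xi>\<close>-components \<open>\<xi>(\<eta>(X))\<close> and \<open>\<eta>(B)\<close> cancel, because both are \<open>\<eta>(D'\<^sub>\<xi> X)\<close> up to
  sign, and \<open>- D'\<^sub>\<xi> X - B = - D'\<^sub>X \<xi>\<close>.
\<close>

lemma curvature_xi_xi:
  assumes X: "vector_field A X"
  shows "curvature A g' X \<xi> \<xi> p = \<eta> p (X p) *\<^sub>R \<xi> p - X p"
proof -
  note xi = vector_field_xi
  note aff = affine_connection_D'
  let ?B = "lie_bracket A X \<xi>"
  have B: "?B = (\<lambda>p. D' X \<xi> p - D' \<xi> X p)"
    using levi_civita_torsion_free[OF is_levi_civita_D' X xi] by auto
  have vB: "vector_field A ?B"
    unfolding B by (intro vector_field_diff affine_connection_vector_field[OF aff] X xi)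
  have xi_xi: "D' \<xi> \<xi> = (\<lambda>p. 0)" by (simp add: D'_xi[OF xi] eta_xi)
  have \<eta>X: "smooth_function A (\<lambda>p. - 1 * \<eta> p (X p))"
    by (intro smooth_function_mult smooth_function_const smooth_function_eta X)
  have "D' \<xi> (D' X \<xi>) p = D' \<xi> X p - deriv_along A \<xi> (\<lambda>p. \<eta> p (X p)) p *\<^sub>R \<xi> p"
    unfolding D'_xi[OF X]
      affine_connection_add_right[OF aff xi X vector_field_scaleR[OF \<eta>X xi]]
      affine_connection_scaleR_right[OF aff xi xi \<eta>X] xi_xi
      deriv_along_cmult[OF smooth_function_eta[OF X]] by simp
  also have "deriv_along A \<xi> (\<lambda>p. \<eta> p (X p)) p = \<eta> p (D' \<xi> X p)"
    by (simp add: deriv_along_eta[OF xi X] D'_xi_left eta_xi flip: eta_eq)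
  finally have 1: "D' \<xi> (D' X \<xi>) p = D' \<xi> X p - \<eta> p (D' \<xi> X p) *\<^sub>R \<xi> p" .
  have 2: "D' ?B \<xi> p = ?B p - \<eta> p (?B p) *\<^sub>R \<xi> p" by (simp add: D'_xi[OF vB])
  have 3: "?B p = X p - \<eta> p (X p) *\<^sub>R \<xi> p - D' \<xi> X p"
    by (simp add: B D'_xi[OF X])
  have 4: "\<eta> p (?B p) = - \<eta> p (D' \<xi> X p)"
    unfolding 3 by (simp add: tensor_simps eta_xi)
  have "curvature A g' X \<xi> \<xi> p = D' X (D' \<xi> \<xi>) p - D' \<xi> (D' X \<xi>) p - D' ?B \<xi> p"
    using levi_civita_g' affine_connection_vector_field[OF aff] X xi vB by (simp add: curvature_def)
  also have "\<dots> = \<eta> p (X p) *\<^sub>R \<xi> p - X p"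
    unfolding xi_xi affine_connection_zero_right[OF aff X] 1 2 4 unfolding 3 by simp
  finally show ?thesis .
qed

lemma ricci_xi_xi: "ricci A g' \<xi> \<xi> p = 1 - real DIM('e)"
proof -
  have "ricci A g' \<xi> \<xi> p = (\<Sum>b\<in>Basis. (\<eta> p b *\<^sub>R \<xi> p - b) \<bullet> b)"
    by (simp add: ricci_def trace_at_def curvature_xi_xi[OF vector_field_extend_vector] extend_vector_at)
  also have "\<dots> = \<eta> p (\<Sum>b\<in>Basis. (\<xi> p \<bullet> b) *\<^sub>R b) - real DIM('e)"
    by (simp add: inner_diff_left sum_subtractf linear_sum[OF linear_eta] linear_cmul[OF linear_eta] mult.commute)
  also have "\<dots> = 1 - real DIM('e)" by (simp add: euclidean_representation eta_xi)
  finally show ?thesis .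
qed

text \<open>
  As \<open>g'(\<xi>, \<xi>)\<close> is constant, only \<open>- 2 g'([V, \<xi>], \<xi>)\<close> contributes. In \<open>[V, \<xi>] = D'\<^sub>V \<xi> - D'\<^sub>\<xi> V\<close> the first
  term is orthogonal to \<open>\<xi>\<close>, and \<open>D'\<^sub>\<xi> \<xi> = 0\<close> allows to pull \<open>\<xi>\<close> out of the product in the second.
\<close>

lemma lie_derivative_gradient_xi_xi:
  assumes "smooth_function A f" "vector_field A (gradient A g' f)"
  shows "lie_derivative_metric A (gradient A g' f) g' \<xi> \<xi> p = 2 * deriv_along A \<xi> (deriv_along A \<xi> f) p"
proof -
  let ?V = "gradient A g' f"
  note xi = vector_field_xi and V = assms(2)
  note bil = riemannian_metric_bilinear[OF riemannian_metric_g', of p]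
  have "D' \<xi> \<xi> p = 0" by (simp add: D'_xi[OF xi] eta_xi)
  moreover have "(\<lambda>q. g' q (?V q) (\<xi> q)) = deriv_along A \<xi> f"
    by (simp add: metric_gradient[OF riemannian_metric_g' assms(1)] deriv_along_def fun_eq_iff)
  ultimately have "g' p (D' \<xi> ?V p) (\<xi> p) = deriv_along A \<xi> (deriv_along A \<xi> f) p"
    using levi_civita_metric[OF is_levi_civita_D' xi V xi, of p] bilinear_rzero[OF bil] by simp
  moreover have "g' p (D' ?V \<xi> p) (\<xi> p) = 0"
    by (simp add: g'_xi D'_xi[OF V] tensor_simps eta_xi)
  ultimately have "g' p (lie_bracket A ?V \<xi> p) (\<xi> p) = - deriv_along A \<xi> (deriv_along A \<xi> f) p"
    by (simp add: levi_civita_torsion_free[OF is_levi_civita_D' V xi] bilinear_lsub[OF bil])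
  then show ?thesis
    using riemannian_metric_sym[OF riemannian_metric_g', of p "\<xi> p"]
    by (simp add: lie_derivative_metric_def g'_xi eta_xi deriv_along_const)
qed

end

section \<open>The soliton function\<close>

theorem theorem4p6:
  fixes A :: "('m::{t2_space,second_countable_topology}, 'e::euclidean_space) chart set"
    and \<phi> \<phi>' :: "'m \<Rightarrow> 'e \<Rightarrow> 'e"
    and \<xi> \<xi>' V :: "'m \<Rightarrow> 'e"
    and \<eta> \<eta>' :: "'m \<Rightarrow> 'e \<Rightarrow> real"
    and g g' :: "'m \<Rightarrow> 'e \<Rightarrow> 'e \<Rightarrow> real"
    and f lam' :: "'m \<Rightarrow> real"
    and a :: real and n :: nat
  assumes "smooth_atlas A"
    and "n \<ge> 1" and "DIM('e) = 2 * n + 1"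
    and "kenmotsu A \<phi> \<xi> \<eta> g"
    and "a > 0"
    and "(\<phi>', \<xi>', \<eta>', g') = D_homothetic a (\<phi>, \<xi>, \<eta>, g)"
    and "smooth_function A f"
    and "V = gradient A g' f"
    and "gradient_almost_ricci_soliton A g' V lam'"
  shows "lam' = (\<lambda>p. 1 / a\<^sup>2 * hessian A g f \<xi> \<xi> p - 2 * real n / a\<^sup>2)"
proof
  fix p
  interpret K: deformed_kenmotsu_manifold A \<phi> \<xi> \<eta> g a
    by unfold_locales (use assms in auto)
  have g': "g' = K.g'"
    using assms(6) by (simp add: D_homothetic_def K.g'_def[abs_def])
  have soliton: "almost_ricci_soliton A K.g' (gradient A K.g' f) lam'"
    using assms(8,9) by (simp add: gradient_almost_ricci_soliton_def g')
  then have "vector_field A (gradient A K.g' f)" by (simp add: almost_ricci_soliton_def)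
  note lie = K.lie_derivative_gradient_xi_xi[OF assms(7) this, of p]
  have "1 / 2 * lie_derivative_metric A (gradient A K.g' f) K.g' \<xi> \<xi> p + ricci A K.g' \<xi> \<xi> p
      = lam' p * K.g' p (\<xi> p) (\<xi> p)"
    using soliton K.vector_field_xi by (simp add: almost_ricci_soliton_def)
  then have "deriv_along A \<xi> (deriv_along A \<xi> f) p - 2 * real n = lam' p * a\<^sup>2"
    using assms(3) by (simp add: lie K.ricci_xi_xi K.g'_xi K.eta_xi)
  moreover have "hessian A g f \<xi> \<xi> p = deriv_along A \<xi> (deriv_along A \<xi> f) p"
  proof -
    have "levi_civita A g \<xi> \<xi> p = 0" by (simp add: K.D_xi[OF K.vector_field_xi] K.eta_xi)
    then show ?thesis
      using linear_0[OF K.linear_differential[OF assms(7)]] by (simp add: hessian_def deriv_along_def)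
  qed
  ultimately show "lam' p = 1 / a\<^sup>2 * hessian A g f \<xi> \<xi> p - 2 * real n / a\<^sup>2"
    using assms(5) by (simp add: field_simps)
qed

end
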